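(* Let $q$ be a prime power and let $n\geq 2$ be an integer. Let $\Gamma_n(q)$ be the regular graph over $M_n(\mathbb{F}_q)$, that is, the simple graph with vertex set $GL_n(\mathbb{F}_q)$ in which two distinct matrices $a,b\in GL_n(\mathbb{F}_q)$ are joined by an edge if and only if $\det(a+b)=0$. Then the independence number of $\Gamma_n(q)$ satisfies \[\alpha(\Gamma_n(q))\leq q^{n^2-n+1}.\]
   Context: $\mathbb{F}_q$ is the finite field with $q$ elements (of any characteristic, $q$ even or odd), $M_n(\mathbb{F}_q)$ is the ring of $n\times n$ matrices over $\mathbb{F}_q$, and $GL_n(\mathbb{F}_q)$ is the group of non-singular matrices in $M_n(\mathbb{F}_q)$. The independence number $\alpha(X)$ of a finite graph $X$ is the maximal size of a set of pairwise non-adjacent vertices. *)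

theory Defs
  imports
    "Graph_Theory.Pair_Digraph"
    "Jordan_Normal_Form.Determinant"
    "HOL-Number_Theory.Prime_Powers"
    "HOL-Library.Cardinality"
begin

text \<open>Finite simple graphs are the \<^locale>\<open>pair_graph\<close>s of the library: finite, loop-free, with a
  symmetric arc relation, so that an edge is represented by its two orientations.\<close>

definition independent_set :: "'v pair_pre_digraph \<Rightarrow> 'v set \<Rightarrow> bool" where
  "independent_set G S \<longleftrightarrow>
     S \<subseteq> pverts G \<and> (\<forall>u\<in>S. \<forall>v\<in>S. u \<noteq> v \<longrightarrow> (u, v) \<notin> parcs G)"

text \<open>Meaningful for graphs with finitely many vertices, since \<^const>\<open>Max\<close> is unspecified on
  infinite sets.\<close>

definition independence_number :: "'v pair_pre_digraph \<Rightarrow> nat" where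
  "independence_number G = Max {card S | S. independent_set G S}"

lemma independence_number_attained:
  assumes "finite (pverts G)"
  shows "\<exists>S. independent_set G S \<and> card S = independence_number G"
    and "independent_set G S \<Longrightarrow> card S \<le> independence_number G"
proof -
  let ?C = "{card S | S. independent_set G S}"
  have "?C \<subseteq> card ` Pow (pverts G)"
    by (auto simp: independent_set_def)
  then have fin: "finite ?C"
    using assms by (meson finite_Pow_iff finite_imageI finite_subset)
  have "independent_set G {}"
    by (simp add: independent_set_def)
  then have "?C \<noteq> {}"
    by blast
  with fin have "independence_number G \<in> ?C"
    unfolding independence_number_def by (rule Max_in)
  then show "\<exists>S. independent_set G S \<and> card S = independence_number G"
    by auto
  show "card S \<le> independence_number G" if "independent_set G S"
    unfolding independence_number_def using fin that by (intro Max_ge) auto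
qed

definition general_linear :: "nat \<Rightarrow> 'a :: field mat set" where
  "general_linear n = {A \<in> carrier_mat n n. det A \<noteq> 0}"

definition regular_graph :: "nat \<Rightarrow> 'a :: field mat pair_pre_digraph" where
  "regular_graph n =
     \<lparr> pverts = general_linear n,
       parcs = {(a, b). a \<in> general_linear n \<and> b \<in> general_linear n \<and>
                        a \<noteq> b \<and> det (a + b) = 0} \<rparr>"

lemma finite_carrier_mat: "finite (carrier_mat m n :: 'a :: finite mat set)"
proof -
  let ?F = "PiE ({..<m} \<times> {..<n}) (\<lambda>_. UNIV :: 'a set)"
  have "A \<in> mat m n ` ?F" if "A \<in> carrier_mat m n" for A :: "'a mat"
  proof
    show "A = mat m n (restrict (($$) A) ({..<m} \<times> {..<n}))"
      using that by (intro eq_matI) auto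
  qed auto
  then have "carrier_mat m n \<subseteq> mat m n ` ?F"
    by blast
  moreover have "finite ?F"
    by (intro finite_PiE) auto
  ultimately show ?thesis
    by (meson finite_imageI finite_subset)
qed

lemma pair_graph_regular_graph:
  "pair_graph (regular_graph n :: 'a :: {field, finite} mat pair_pre_digraph)"
proof -
  have fin: "finite (general_linear n :: 'a mat set)"
    unfolding general_linear_def by (rule finite_subset[OF _ finite_carrier_mat]) auto
  have "parcs (regular_graph n :: 'a mat pair_pre_digraph)
          \<subseteq> general_linear n \<times> general_linear n"
    by (auto simp: regular_graph_def)
  then have "finite (parcs (regular_graph n :: 'a mat pair_pre_digraph))"
    using fin by (meson finite_SigmaI finite_subset)
  moreover have "a + b = b + a" if "a \<in> general_linear n" "b \<in> general_linear n"
    for a b :: "'a mat"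
    using that by (auto simp: general_linear_def intro: comm_add_mat)
  ultimately show ?thesis
    using fin by unfold_locales (auto simp: regular_graph_def symmetric_def intro!: symI)
qed

end

theory Submission
  imports Defs "HOL-Analysis.Convex" "Berlekamp_Zassenhaus.Berlekamp_Type_Based"
begin

unbundle no inner_syntax

text \<open>
  Let \<open>S\<close> be independent. In characteristic 2 all differences of distinct elements of \<open>S\<close> are
  invertible, so the first column determines an element of \<open>S\<close>, whence \<open>\<bar>S\<bar> \<le> q\<^sup>n\<close>.

  In odd characteristic every \<open>a - b\<close> with \<open>a \<in> S\<close>, \<open>b \<in> - S\<close> is invertible: for \<open>b \<noteq> - a\<close> by
  independence, and for \<open>b = - a\<close> because \<open>det (2a) \<noteq> 0\<close>. Hence for every \<open>v \<noteq> 0\<close> the map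
  \<open>x \<mapsto> x v\<close> sends \<open>S\<close> and \<open>- S\<close> to disjoint sets of vectors. The bound comes from using this for
  \<open>q\<^sup>n\<^sup>-\<^sup>1\<close> vectors at once, namely those with first coordinate 1; they lie on distinct lines.
  Consider \<open>h = 1\<^sub>S - 1\<^sub>-\<^sub>S\<close> in the Euclidean space of real functions on all \<open>n \<times> n\<close> matrices. Each \<open>v\<close>
  gives the subspace of the functions \<open>x \<mapsto> g (x v)\<close> with \<open>g\<close> of sum 0, and two vectors on
  distinct lines give orthogonal subspaces, since \<open>x v\<close> and \<open>x v'\<close> are then independent and uniformly
  distributed (\<open>fibre_average\<close>). Bessel's inequality (\<open>fibre_sum_bessel\<close>) therefore bounds
  the sum of the squared projections of \<open>h\<close> by \<open>\<parallel>h\<parallel>\<^sup>2 = 2 \<bar>S\<bar>\<close>. On the other hand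
  no cancellation occurs in the fibres of \<open>x \<mapsto> x v\<close>, which makes each squared
  projection at least \<open>4 \<bar>S\<bar>\<^sup>2 / q\<^bsup>n * n\<^esup>\<close>. Comparing the two gives
  \<open>2 \<bar>S\<bar> q\<^sup>n\<^sup>-\<^sup>1 \<le> q\<^bsup>n * n\<^esup>\<close> (\<open>card_le_if_cross_differences_invertible\<close>).
\<close>

section \<open>Counting\<close>

lemma card_carrier_mat:
  "card (carrier_mat m n :: 'a :: finite mat set) = CARD('a) ^ (m * n)"
proof -
  let ?I = "{..<m} \<times> {..<n}"
  have "bij_betw (mat m n) (PiE ?I (\<lambda>_. UNIV :: 'a set)) (carrier_mat m n)"
  proof (rule bij_betw_byWitness[where f' = "\<lambda>A. restrict (($$) A) ?I"])
    show "\<forall>f\<in>PiE ?I (\<lambda>_. UNIV :: 'a set). restrict (($$) (mat m n f)) ?I = f"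
      by (auto simp: PiE_def extensional_def restrict_def fun_eq_iff)
  qed (auto simp: restrict_def split: if_splits)
  then show ?thesis
    by (auto simp: bij_betw_same_card[symmetric] card_PiE card_cartesian_product)
qed

text \<open>These are representatives of the points of an affine chart of projective space. The chart
  already has \<open>q\<^sup>n\<^sup>-\<^sup>1\<close> points, and unlike the whole projective space it needs no choice of
  representatives.\<close>

definition dehomogenized_vecs :: "nat \<Rightarrow> 'a :: field vec set" where
  "dehomogenized_vecs n = {v \<in> carrier_vec n. v $ 0 = 1}"

lemma card_dehomogenized_vecs:
  "card (dehomogenized_vecs (Suc k) :: 'a :: {field, finite} vec set) = CARD('a) ^ k"
proof -
  have "dehomogenized_vecs (Suc k) = vCons (1 :: 'a) ` carrier_vec k"
  proof (intro equalityI subsetI)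
    fix v :: "'a vec" assume "v \<in> dehomogenized_vecs (Suc k)"
    then show "v \<in> vCons 1 ` carrier_vec k"
      by (cases v) (auto simp: dehomogenized_vecs_def)
  qed (auto simp: dehomogenized_vecs_def)
  moreover have "inj_on (vCons (1 :: 'a)) (carrier_vec k)"
    by (auto intro: inj_onI)
  ultimately show ?thesis
    by (simp add: card_image card_carrier_vec)
qed

text \<open>Linear independence of two chart points, in the form in which the averaging argument
  consumes it.\<close>

lemma separating_functional:
  fixes v v' :: "'a :: field vec"
  assumes "v \<in> dehomogenized_vecs n" "v' \<in> dehomogenized_vecs n" "v \<noteq> v'" "n > 0"
  obtains r where "r \<in> carrier_vec n" "r \<bullet> v = 0" "r \<bullet> v' = 1"
proof -
  have vs: "v \<in> carrier_vec n" "v' \<in> carrier_vec n" "v $ 0 = 1" "v' $ 0 = 1"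
    using assms by (auto simp: dehomogenized_vecs_def)
  then obtain i where i: "i < n" "v $ i \<noteq> v' $ i"
    using assms(3) by (metis carrier_vecD eq_vecI)
  (* subtracting v $ i times the first coordinate makes the functional vanish on v,
     because v $ 0 = 1 *)
  define r where "r = inverse (v' $ i - v $ i) \<cdot>\<^sub>v (unit_vec n i - v $ i \<cdot>\<^sub>v unit_vec n 0)"
  have "r \<bullet> w = inverse (v' $ i - v $ i) * (w $ i - v $ i * w $ 0)" if "w \<in> carrier_vec n" for w
    using that i(1) assms(4) by (simp add: r_def minus_scalar_prod_distrib[of _ n])
  then show thesis
    using i(2) vs by (intro that[of r]) (auto simp: r_def)
qed

section \<open>Equidistribution of the fibres\<close>

lemma rank_one_mult_mat_vec:
  fixes r u v :: "'a :: comm_ring_1 vec"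
  assumes "r \<in> carrier_vec n" "u \<in> carrier_vec m" "v \<in> carrier_vec n"
  shows "mat m n (\<lambda>(i, j). u $ i * r $ j) *\<^sub>v v = (r \<bullet> v) \<cdot>\<^sub>v u"
  using assms
  by (intro eq_vecI) (auto simp: scalar_prod_def sum_distrib_left sum_distrib_right mult_ac intro!: sum.cong)

lemma bij_betw_add_vec:
  fixes w :: "'a :: ab_group_add vec"
  assumes "w \<in> carrier_vec n"
  shows "bij_betw (\<lambda>u. w + u) (carrier_vec n) (carrier_vec n)"
  using assms by (intro bij_betw_byWitness[where f' = "\<lambda>u. - w + u"]) (auto intro!: eq_vecI)

lemma bij_betw_add_mat:
  fixes y :: "'a :: ab_group_add mat"
  assumes "y \<in> carrier_mat m n"
  shows "bij_betw (\<lambda>x. x + y) (carrier_mat m n) (carrier_mat m n)"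
  using assms by (intro bij_betw_byWitness[where f' = "\<lambda>x. x - y"]) (auto intro!: eq_matI)

text \<open>Translating \<open>x\<close> by the rank one matrix \<open>u r\<^sup>T\<close> leaves \<open>x v\<close> alone and moves \<open>x v'\<close> by \<open>u\<close>.
  Averaging over all \<open>u\<close> thus replaces \<open>g (x v')\<close> by the mean of \<open>g\<close>. For \<open>v = 0\<close> and \<open>f = 1\<close> this
  says that \<open>x v'\<close> is uniformly distributed.\<close>

lemma fibre_average:
  fixes f g :: "'a :: {field, finite} vec \<Rightarrow> real"
  assumes v: "v \<in> carrier_vec n" and v': "v' \<in> carrier_vec n"
    and r: "r \<in> carrier_vec n" "r \<bullet> v = 0" "r \<bullet> v' = 1"
  shows "real CARD('a) ^ m * (\<Sum>x\<in>carrier_mat m n. f (x *\<^sub>v v) * g (x *\<^sub>v v'))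
       = (\<Sum>x\<in>carrier_mat m n. f (x *\<^sub>v v)) * (\<Sum>w\<in>carrier_vec m. g w)"
proof -
  let ?M = "carrier_mat m n :: 'a mat set" and ?V = "carrier_vec m :: 'a vec set"
  have shift: "(\<Sum>x\<in>?M. f (x *\<^sub>v v) * g (x *\<^sub>v v')) = (\<Sum>x\<in>?M. f (x *\<^sub>v v) * g (x *\<^sub>v v' + u))"
    if u: "u \<in> ?V" for u
  proof -
    let ?y = "mat m n (\<lambda>(i, j). u $ i * r $ j)"
    have yv: "?y *\<^sub>v v = 0\<^sub>v m" and yv': "?y *\<^sub>v v' = u"
      using u v v' r by (auto simp: rank_one_mult_mat_vec)
    have "(\<Sum>x\<in>?M. f (x *\<^sub>v v) * g (x *\<^sub>v v'))
        = (\<Sum>x\<in>?M. f ((x + ?y) *\<^sub>v v) * g ((x + ?y) *\<^sub>v v'))"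
      by (rule sum.reindex_bij_betw[symmetric, OF bij_betw_add_mat]) auto
    also have "\<dots> = (\<Sum>x\<in>?M. f (x *\<^sub>v v) * g (x *\<^sub>v v' + u))"
    proof (rule sum.cong[OF refl])
      fix x assume x: "x \<in> ?M"
      have "x *\<^sub>v v + 0\<^sub>v m = x *\<^sub>v v"
        using x v by (intro right_zero_vec mult_mat_vec_carrier)
      then show "f ((x + ?y) *\<^sub>v v) * g ((x + ?y) *\<^sub>v v') = f (x *\<^sub>v v) * g (x *\<^sub>v v' + u)"
        using x v v' by (simp add: add_mult_distrib_mat_vec[of _ m n] yv yv')
    qed
    finally show ?thesis .
  qed
  have "real CARD('a) ^ m * (\<Sum>x\<in>?M. f (x *\<^sub>v v) * g (x *\<^sub>v v'))
      = (\<Sum>u\<in>?V. \<Sum>x\<in>?M. f (x *\<^sub>v v) * g (x *\<^sub>v v' + u))"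
    by (simp add: shift[symmetric] card_carrier_vec)
  also have "\<dots> = (\<Sum>x\<in>?M. f (x *\<^sub>v v) * (\<Sum>u\<in>?V. g (x *\<^sub>v v' + u)))"
    by (subst sum.swap) (simp add: sum_distrib_left)
  also have "\<dots> = (\<Sum>x\<in>?M. f (x *\<^sub>v v) * (\<Sum>w\<in>?V. g w))"
  proof (rule sum.cong[OF refl])
    fix x assume "x \<in> ?M"
    then have "x *\<^sub>v v' \<in> ?V"
      using v' by simp
    from sum.reindex_bij_betw[OF bij_betw_add_vec[OF this], of g]
    show "f (x *\<^sub>v v) * (\<Sum>u\<in>?V. g (x *\<^sub>v v' + u)) = f (x *\<^sub>v v) * (\<Sum>w\<in>?V. g w)"
      by simp
  qed
  finally show ?thesis
    by (simp add: sum_distrib_right)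
qed

section \<open>The Bessel inequality\<close>

text \<open>Up to a constant factor, \<open>x \<mapsto> fibre_sum m n h v (x v)\<close> is the orthogonal projection of \<open>h\<close> onto
  the functions that depend only on \<open>x v\<close>.\<close>

definition fibre_sum :: "nat \<Rightarrow> nat \<Rightarrow> ('a :: field mat \<Rightarrow> real) \<Rightarrow> 'a vec \<Rightarrow> 'a vec \<Rightarrow> real" where
  "fibre_sum m n h v w = (\<Sum>x | x \<in> carrier_mat m n \<and> x *\<^sub>v v = w. h x)"

lemma sum_fibre_sum_mult:
  fixes h :: "'a :: {field, finite} mat \<Rightarrow> real"
  assumes "v \<in> carrier_vec n"
  shows "(\<Sum>w\<in>carrier_vec m. s w * fibre_sum m n h v w)
       = (\<Sum>x\<in>carrier_mat m n. s (x *\<^sub>v v) * h x)"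
proof -
  have "(\<Sum>x\<in>carrier_mat m n. s (x *\<^sub>v v) * h x)
      = (\<Sum>w\<in>carrier_vec m. \<Sum>x | x \<in> carrier_mat m n \<and> x *\<^sub>v v = w. s (x *\<^sub>v v) * h x)"
    using assms
    by (intro sum.group[symmetric] finite_carrier_mat finite_carrier_vec) (auto simp: image_subset_iff)
  also have "\<dots> = (\<Sum>w\<in>carrier_vec m. s w * fibre_sum m n h v w)"
    unfolding fibre_sum_def sum_distrib_left by (intro sum.cong) auto
  finally show ?thesis by simp
qed

text \<open>Bessel's inequality for the projections of \<open>h\<close>. Let \<open>E\<close> be the double sum of squares and \<open>F\<close> the
  sum of the projections, up to a constant factor. Then \<open>\<langle>h, F\<rangle> = E\<close> by \<open>sum_fibre_sum_mult\<close>, and \<open>\<parallel>F\<parallel>\<^sup>2\<close> is a constant multiple of \<open>E\<close> because the mixed terms vanish.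
  The hypothesis that \<open>h\<close> has mean 0 removes the constant functions, which the subspaces belonging to
  different \<open>v\<close> would otherwise share.\<close>

lemma fibre_sum_bessel:
  fixes h :: "'a :: {field, finite} mat \<Rightarrow> real"
  assumes n: "n > 0" and mean: "(\<Sum>x\<in>carrier_mat m n. h x) = 0"
  shows "real CARD('a) ^ m * (\<Sum>v\<in>dehomogenized_vecs n. \<Sum>w\<in>carrier_vec m. (fibre_sum m n h v w)\<^sup>2)
       \<le> real CARD('a) ^ (m * n) * (\<Sum>x\<in>carrier_mat m n. (h x)\<^sup>2)"
proof -
  let ?M = "carrier_mat m n :: 'a mat set" and ?V = "carrier_vec m :: 'a vec set"
    and ?W = "dehomogenized_vecs n :: 'a vec set" and ?Q = "real CARD('a) ^ m"
  let ?H = "fibre_sum m n h"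
  define F where "F x = (\<Sum>v\<in>?W. ?H v (x *\<^sub>v v))" for x
  define E where "E = (\<Sum>v\<in>?W. \<Sum>w\<in>?V. (?H v w)\<^sup>2)"
  have finW: "finite ?W"
    unfolding dehomogenized_vecs_def by (rule finite_subset[OF _ finite_carrier_vec[of n]]) auto
  have W: "v \<in> carrier_vec n" "v $ 0 = 1" if "v \<in> ?W" for v
    using that by (auto simp: dehomogenized_vecs_def)
  have zero: "(\<Sum>w\<in>?V. ?H v w) = 0" if "v \<in> ?W" for v
    using sum_fibre_sum_mult[OF W(1)[OF that], of "\<lambda>_. 1"] mean by simp
  have "(\<Sum>x\<in>?M. h x * F x) = (\<Sum>v\<in>?W. \<Sum>x\<in>?M. ?H v (x *\<^sub>v v) * h x)"
    unfolding F_def sum_distrib_left by (subst sum.swap) (simp add: mult_ac)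
  also have "\<dots> = E"
    unfolding E_def by (intro sum.cong refl) (simp add: sum_fibre_sum_mult[OF W(1), symmetric] power2_eq_square)
  finally have hF: "(\<Sum>x\<in>?M. h x * F x) = E" .
  have corr: "?Q * (\<Sum>x\<in>?M. ?H v (x *\<^sub>v v) * ?H v' (x *\<^sub>v v'))
      = (if v = v' then real CARD('a) ^ (m * n) * (\<Sum>w\<in>?V. (?H v w)\<^sup>2) else 0)"
    if v: "v \<in> ?W" and v': "v' \<in> ?W" for v v'
  proof (cases "v = v'")
    case True
    have "?Q * (\<Sum>x\<in>?M. 1 * (?H v (x *\<^sub>v v))\<^sup>2) = (\<Sum>x\<in>?M. 1) * (\<Sum>w\<in>?V. (?H v w)\<^sup>2)"
      using W[OF v] n
      by (intro fibre_average[where v = "0\<^sub>v n" and r = "unit_vec n 0" and f = "\<lambda>_. 1"]) auto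
    then show ?thesis
      using True by (simp add: card_carrier_mat power2_eq_square)
  next
    case False
    obtain r where "r \<in> carrier_vec n" "r \<bullet> v = 0" "r \<bullet> v' = 1"
      using separating_functional[OF v v' False n] .
    from fibre_average[OF W(1)[OF v] W(1)[OF v'] this] show ?thesis
      using False zero[OF v'] by simp
  qed
  have "?Q * (\<Sum>x\<in>?M. (F x)\<^sup>2)
      = ?Q * (\<Sum>v\<in>?W. \<Sum>v'\<in>?W. \<Sum>x\<in>?M. ?H v (x *\<^sub>v v) * ?H v' (x *\<^sub>v v'))"
    unfolding F_def power2_eq_square sum_product
    by (subst sum.swap, subst (2) sum.swap) simp
  also have "\<dots> = (\<Sum>v\<in>?W. \<Sum>v'\<in>?W. ?Q * (\<Sum>x\<in>?M. ?H v (x *\<^sub>v v) * ?H v' (x *\<^sub>v v')))"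
    by (simp add: sum_distrib_left)
  also have "\<dots> = (\<Sum>v\<in>?W. real CARD('a) ^ (m * n) * (\<Sum>w\<in>?V. (?H v w)\<^sup>2))"
    using finW by (simp add: corr)
  also have "\<dots> = real CARD('a) ^ (m * n) * E"
    by (simp add: E_def sum_distrib_left)
  finally have FF: "?Q * (\<Sum>x\<in>?M. (F x)\<^sup>2) = real CARD('a) ^ (m * n) * E" .
  have "E\<^sup>2 \<le> (\<Sum>x\<in>?M. (h x)\<^sup>2) * (\<Sum>x\<in>?M. (F x)\<^sup>2)"
    using Cauchy_Schwarz_ineq_sum[of h F ?M] by (simp add: hF)
  then have "?Q * E\<^sup>2 \<le> ?Q * ((\<Sum>x\<in>?M. (h x)\<^sup>2) * (\<Sum>x\<in>?M. (F x)\<^sup>2))"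
    by (intro mult_left_mono) auto
  also have "\<dots> = (\<Sum>x\<in>?M. (h x)\<^sup>2) * (?Q * (\<Sum>x\<in>?M. (F x)\<^sup>2))"
    by simp
  also have "\<dots> = (real CARD('a) ^ (m * n) * (\<Sum>x\<in>?M. (h x)\<^sup>2)) * E"
    by (simp add: FF)
  finally have le: "(?Q * E) * E \<le> (real CARD('a) ^ (m * n) * (\<Sum>x\<in>?M. (h x)\<^sup>2)) * E"
    by (simp add: power2_eq_square mult_ac)
  have "E \<ge> 0"
    by (auto simp: E_def intro!: sum_nonneg)
  show ?thesis
  proof (cases "E = 0")
    case True
    then show ?thesis
      unfolding E_def[symmetric] by (simp add: sum_nonneg)
  next
    case False
    then show ?thesis
      using le \<open>E \<ge> 0\<close> unfolding E_def[symmetric] by (simp add: mult_le_cancel_right)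
  qed
qed

section \<open>Sets of matrices with invertible differences\<close>

lemma mult_mat_vec_neq:
  fixes a b :: "'a :: field mat"
  assumes "a \<in> carrier_mat n n" "b \<in> carrier_mat n n" "det (a - b) \<noteq> 0"
    and "v \<in> carrier_vec n" "v \<noteq> 0\<^sub>v n"
  shows "a *\<^sub>v v \<noteq> b *\<^sub>v v"
proof
  assume "a *\<^sub>v v = b *\<^sub>v v"
  then have "(a - b) *\<^sub>v v = 0\<^sub>v n"
    using assms by (simp add: minus_mult_distrib_mat_vec[of _ n n])
  then show False
    using assms det_0_iff_vec_prod_zero[OF minus_carrier_mat[OF assms(2)], of a] by auto
qed

lemma card_le_if_differences_invertible:
  fixes S :: "'a :: {field, finite} mat set"
  assumes S: "S \<subseteq> carrier_mat n n" and n: "n > 0"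
    and inv: "\<And>a b. a \<in> S \<Longrightarrow> b \<in> S \<Longrightarrow> a \<noteq> b \<Longrightarrow> det (a - b) \<noteq> 0"
  shows "card S \<le> CARD('a) ^ n"
proof -
  let ?v = "unit_vec n 0 :: 'a vec"
  have "inj_on (\<lambda>a. a *\<^sub>v ?v) S"
  proof (rule inj_onI, rule ccontr)
    fix a b assume "a \<in> S" "b \<in> S" "a *\<^sub>v ?v = b *\<^sub>v ?v" "a \<noteq> b"
    then show False
      using mult_mat_vec_neq[of a n b ?v] inv[of a b] S n by auto
  qed
  then have "card S \<le> card (carrier_vec n :: 'a vec set)"
    using S by (intro card_inj_on_le) auto
  then show ?thesis
    by (simp add: card_carrier_vec)
qed

text \<open>For each \<open>v\<close>, testing the fibre sums of \<open>h = 1\<^sub>A - 1\<^sub>B\<close> against a sign function \<open>s\<close> that is 1 on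
  \<open>A v\<close> and \<open>- 1\<close> on \<open>B v\<close> gives \<open>\<bar>A\<bar> + \<bar>B\<bar>\<close>, so they cannot be small; Bessel's inequality says
  that they cannot be large for many \<open>v\<close>. The two sets have equal size so that \<open>h\<close> has mean 0.\<close>

lemma card_le_if_cross_differences_invertible:
  fixes A B :: "'a :: {field, finite} mat set"
  assumes A: "A \<subseteq> carrier_mat n n" and B: "B \<subseteq> carrier_mat n n" and n: "n > 0"
    and eq: "card A = card B"
    and inv: "\<And>a b. a \<in> A \<Longrightarrow> b \<in> B \<Longrightarrow> det (a - b) \<noteq> 0"
  shows "2 * card A * CARD('a) ^ (n - 1) \<le> CARD('a) ^ (n * n)"
proof -
  let ?M = "carrier_mat n n :: 'a mat set" and ?V = "carrier_vec n :: 'a vec set"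
    and ?W = "dehomogenized_vecs n :: 'a vec set" and ?q = "real CARD('a)"
  define c where "c = real (card A)"
  define h :: "'a mat \<Rightarrow> real" where "h x = of_bool (x \<in> A) - of_bool (x \<in> B)" for x
  note finM = finite_carrier_mat[of n n, where 'a = 'a]
  have W: "v \<in> carrier_vec n" "v \<noteq> 0\<^sub>v n" if "v \<in> ?W" for v
    using that n by (auto simp: dehomogenized_vecs_def)
  have neq: "a *\<^sub>v v \<noteq> b *\<^sub>v v" if "a \<in> A" "b \<in> B" "v \<in> ?W" for a b v
    using that A B W inv by (intro mult_mat_vec_neq[of _ n]) auto
  have sumA: "(\<Sum>x\<in>?M. of_bool (x \<in> A)) = c"
    using A finM by (simp add: c_def Int_absorb1)
  have sumB: "(\<Sum>x\<in>?M. of_bool (x \<in> B)) = c"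
    using B finM eq by (simp add: c_def Int_absorb1)
  have disj: "A \<inter> B = {}"
  proof -
    have "unit_vec n 0 \<in> ?W"
      using n by (auto simp: dehomogenized_vecs_def)
    with neq show ?thesis by blast
  qed
  have mean: "(\<Sum>x\<in>?M. h x) = 0"
    by (simp add: h_def sum_subtractf sumA sumB)
  have norm: "(\<Sum>x\<in>?M. (h x)\<^sup>2) = 2 * c"
  proof -
    have "(h x)\<^sup>2 = of_bool (x \<in> A) + of_bool (x \<in> B)" for x
      using disj by (auto simp: h_def)
    then show ?thesis
      by (simp only: sum.distrib sumA sumB)
  qed
  have fibre: "(2 * c)\<^sup>2 \<le> ?q ^ n * (\<Sum>w\<in>?V. (fibre_sum n n h v w)\<^sup>2)" if v: "v \<in> ?W" for v
  proof -
    define s :: "'a vec \<Rightarrow> real" where "s w = (if w \<in> (\<lambda>a. a *\<^sub>v v) ` A then 1 else - 1)" for w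
    have "s (x *\<^sub>v v) * h x = of_bool (x \<in> A) + of_bool (x \<in> B)" for x
      using neq[OF _ _ v] disj by (fastforce simp: s_def h_def)
    then have "(\<Sum>x\<in>?M. s (x *\<^sub>v v) * h x) = 2 * c"
      by (simp only: sum.distrib sumA sumB)
    then have "(2 * c)\<^sup>2 = (\<Sum>w\<in>?V. s w * fibre_sum n n h v w)\<^sup>2"
      by (simp only: sum_fibre_sum_mult[OF W(1)[OF v]])
    also have "\<dots> \<le> (\<Sum>w\<in>?V. (s w)\<^sup>2) * (\<Sum>w\<in>?V. (fibre_sum n n h v w)\<^sup>2)"
      by (rule Cauchy_Schwarz_ineq_sum)
    also have "(\<Sum>w\<in>?V. (s w)\<^sup>2) = (\<Sum>w\<in>?V. 1)"
      by (intro sum.cong) (auto simp: s_def)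
    finally show ?thesis
      by (simp add: card_carrier_vec)
  qed
  have cardW: "card ?W = CARD('a) ^ (n - 1)"
    using card_dehomogenized_vecs[of "n - 1", where 'a = 'a] n by simp
  have "?q ^ (n - 1) * (2 * c)\<^sup>2 = (\<Sum>v\<in>?W. (2 * c)\<^sup>2)"
    by (simp add: cardW)
  also have "\<dots> \<le> (\<Sum>v\<in>?W. ?q ^ n * (\<Sum>w\<in>?V. (fibre_sum n n h v w)\<^sup>2))"
    by (intro sum_mono fibre)
  also have "\<dots> = ?q ^ n * (\<Sum>v\<in>?W. \<Sum>w\<in>?V. (fibre_sum n n h v w)\<^sup>2)"
    by (simp add: sum_distrib_left)
  also have "\<dots> \<le> ?q ^ (n * n) * (2 * c)"
    using fibre_sum_bessel[OF n mean] by (simp add: norm)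
  finally have "(2 * c * ?q ^ (n - 1)) * (2 * c) \<le> ?q ^ (n * n) * (2 * c)"
    by (simp add: power2_eq_square mult_ac)
  then have "2 * c * ?q ^ (n - 1) \<le> ?q ^ (n * n)"
    by (cases "c = 0") (auto simp: c_def mult_le_cancel_right)
  then have "real (2 * card A * CARD('a) ^ (n - 1)) \<le> real (CARD('a) ^ (n * n))"
    by (simp add: c_def)
  then show ?thesis
    by (simp only: of_nat_le_iff)
qed

section \<open>Independent sets\<close>

lemma card_independent_set_le:
  fixes S :: "'a :: {field, finite} mat set"
  assumes S: "independent_set (regular_graph n) S" and n: "n \<ge> 2"
  shows "card S \<le> CARD('a) ^ (n\<^sup>2 - n + 1)"
proof -
  let ?q = "CARD('a)"
  have carrier: "a \<in> carrier_mat n n" "det a \<noteq> 0" if "a \<in> S" for a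
    using S that by (auto simp: independent_set_def regular_graph_def general_linear_def)
  have inv: "det (a + b) \<noteq> 0" if "a \<in> S" "b \<in> S" "a \<noteq> b" for a b
    using S that by (auto simp: independent_set_def regular_graph_def)
  have nn: "n * 2 \<le> n * n"
    using n by (rule mult_le_mono2)
  show ?thesis
  proof (cases "(2 :: 'a) = 0")
    case True
    have "a - b = a + b" if "a \<in> S" "b \<in> S" for a b
    proof -
      have "y + y = 0" for y :: 'a
        using True by (simp add: mult_2[symmetric])
      then have "x - y = x + y" for x y :: 'a
        by (simp add: diff_eq_eq add.assoc)
      then show ?thesis
        using carrier[OF that(1)] carrier[OF that(2)] by (intro eq_matI) auto
    qed
    then have "card S \<le> ?q ^ n"
      using carrier inv n by (intro card_le_if_differences_invertible) auto
    also have "\<dots> \<le> ?q ^ (n\<^sup>2 - n + 1)"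
    proof (rule power_increasing)
      show "n \<le> n\<^sup>2 - n + 1"
        using nn unfolding power2_eq_square by linarith
    qed auto
    finally show ?thesis .
  next
    case False
    have "det (a - - b) \<noteq> 0" if "a \<in> S" "b \<in> S" for a b
    proof -
      have "a - - b = a + b"
        using carrier(1) that by (intro eq_matI) auto
      moreover have "det (a + a) \<noteq> 0"
      proof -
        have "a + a = 2 \<cdot>\<^sub>m a"
          by (intro eq_matI) auto
        then show ?thesis
          using carrier[OF that(1)] False by simp
      qed
      ultimately show ?thesis
        using inv[OF that] by (cases "a = b") auto
    qed
    moreover have "card S = card (uminus ` S)"
      by (simp add: card_image inj_on_def)
    ultimately have "2 * card S * ?q ^ (n - 1) \<le> ?q ^ (n * n)"
      using carrier n by (intro card_le_if_cross_differences_invertible[where B = "uminus ` S"]) auto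
    also have "n * n = (n\<^sup>2 - n + 1) + (n - 1)"
      using nn n by (simp add: power2_eq_square)
    finally have "2 * card S * ?q ^ (n - 1) \<le> ?q ^ (n\<^sup>2 - n + 1) * ?q ^ (n - 1)"
      by (simp only: power_add)
    then show ?thesis
      by simp
  qed
qed

theorem theorem1p1:
  fixes q n :: nat
  assumes "primepow q"
    and "CARD('a :: {field, finite}) = q"
    and "n \<ge> 2"
  shows "independence_number (regular_graph n :: 'a mat pair_pre_digraph) \<le> q ^ (n\<^sup>2 - n + 1)"
proof -
  interpret pair_graph "regular_graph n :: 'a mat pair_pre_digraph"
    by (rule pair_graph_regular_graph)
  obtain S :: "'a mat set" where
    "independent_set (regular_graph n) S" "card S = independence_number (regular_graph n :: 'a mat pair_pre_digraph)"
    using independence_number_attained(1)[of "regular_graph n :: 'a mat pair_pre_digraph"] by auto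
  then show ?thesis
    using card_independent_set_le[of n S] assms by simp
qed

end
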